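(* Let $\mathcal{E}$ be a complex Banach space. Let $A_1$ be the infinitesimal generator of a $C_0$-semigroup $\{T_1(t)\}_{t\ge 0}\in\mathcal{SG}(M_1,\omega_1)$ on $\mathcal{E}$ and let $A_2$ be the infinitesimal generator of a $C_0$-semigroup $\{T_2(t)\}_{t\ge 0}\in\mathcal{SG}(M_2,\omega_2)$ on $\mathcal{E}$. Suppose that there exist $\omega\ge 0$ and $M\ge 1$ such that $$\left\|\left[T_1(t)T_2(t)\right]^k\right\|\le Me^{k\omega t}\qquad\text{for all }k\in\mathbb{N}^*\text{ and all } t\ge 0.$$ If the operator $A:\mathcal{D}(A)\subset\mathcal{E}\to\mathcal{E}$ defined by $$Ax=A_1x+A_2x,\qquad x\in\mathcal{D}(A)=\mathcal{D}(A_1)\cap\mathcal{D}(A_2),$$ is the infinitesimal generator of a $C_0$-semigroup $\{T(t)\}_{t\ge 0}$, then for every $x\in\mathcal{E}$ $$T(t)x=\lim_{n\to\infty}\left[T_1\left(\tfrac{t}{n}\right)T_2\left(\tfrac{t}{n}\right)\right]^n x,$$ uniformly with respect to $t$ on compact intervals of $[0,\infty)$.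
   Context: A $C_0$-semigroup on $\mathcal{E}$ is a family $\{T(t)\}_{t\ge0}$ of bounded linear operators on $\mathcal{E}$ with $T(0)=I$, $T(t+s)=T(t)T(s)$ for $t,s\ge0$, and $\lim_{t\searrow0}T(t)x=x$ for all $x\in\mathcal{E}$. Its infinitesimal generator is $Ax=\lim_{t\searrow0}\frac{T(t)x-x}{t}$, defined on the set $\mathcal{D}(A)$ of those $x$ for which the limit exists. For $M\ge1$, $\omega\ge0$, $\mathcal{SG}(M,\omega)$ is the set of $C_0$-semigroups on $\mathcal{E}$ with $\|T(t)\|\le Me^{\omega t}$ for all $t\ge0$. $\mathbb{N}^*=\{1,2,3,\dots\}$. *)

theory Defs
  imports "HOL-Analysis.Analysis"
begin

text \<open>The real structure inherited from \<^class>\<open>real_normed_vector\<close> is the restriction of the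
  complex one (axiom \<open>scaleR_scaleC\<close>), so the existing topology, norm and completeness are reused.\<close>

class complex_normed_vector = real_normed_vector +
  fixes scaleC :: "complex \<Rightarrow> 'a \<Rightarrow> 'a"  (infixr \<open>*\<^sub>C\<close> 75)
  assumes scaleC_add_right: "a *\<^sub>C (x + y) = a *\<^sub>C x + a *\<^sub>C y"
    and scaleC_add_left: "(a + b) *\<^sub>C x = a *\<^sub>C x + b *\<^sub>C x"
    and scaleC_scaleC: "a *\<^sub>C (b *\<^sub>C x) = (a * b) *\<^sub>C x"
    and scaleR_scaleC: "r *\<^sub>R x = complex_of_real r *\<^sub>C x"
    and norm_scaleC: "norm (a *\<^sub>C x) = cmod a * norm x"

class cbanach = complex_normed_vector + complete_space

subclass (in cbanach) banach ..

instantiation complex :: cbanach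
begin

definition scaleC_complex :: "complex \<Rightarrow> complex \<Rightarrow> complex" where
  "scaleC_complex a x = a * x"

instance
  by standard (simp_all add: scaleC_complex_def algebra_simps norm_mult scaleR_conv_of_real)

end

text \<open>Bounded complex-linear operators. Their operator norm is \<^const>\<open>onorm\<close>, whose definition
  does not depend on the scalar field.\<close>

definition bounded_clinear ::
  "('a::complex_normed_vector \<Rightarrow> 'b::complex_normed_vector) \<Rightarrow> bool" where
  "bounded_clinear f \<longleftrightarrow> bounded_linear f \<and> (\<forall>c x. f (c *\<^sub>C x) = c *\<^sub>C f x)"

text \<open>A family indexed by \<open>t \<ge> 0\<close> is a function on \<^typ>\<open>real\<close> whose values at negative arguments
  are never constrained or used.\<close>

definition C0_semigroup :: "(real \<Rightarrow> 'a::cbanach \<Rightarrow> 'a) \<Rightarrow> bool" where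
  "C0_semigroup T \<longleftrightarrow>
     (\<forall>t\<ge>0. bounded_clinear (T t)) \<and>
     T 0 = id \<and>
     (\<forall>t\<ge>0. \<forall>s\<ge>0. T (t + s) = T t \<circ> T s) \<and>
     (\<forall>x. ((\<lambda>t. T t x) \<longlongrightarrow> x) (at_right 0))"

definition SG :: "real \<Rightarrow> real \<Rightarrow> (real \<Rightarrow> 'a::cbanach \<Rightarrow> 'a) set" where
  "SG M \<omega> = {T. C0_semigroup T \<and> (\<forall>t\<ge>0. onorm (T t) \<le> M * exp (\<omega> * t))}"

definition generator_domain :: "(real \<Rightarrow> 'a::cbanach \<Rightarrow> 'a) \<Rightarrow> 'a set" where
  "generator_domain T = {x. \<exists>y. ((\<lambda>t. (T t x - x) /\<^sub>R t) \<longlongrightarrow> y) (at_right 0)}"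

text \<open>An operator \<open>A : D \<subseteq> E \<rightarrow> E\<close> is a set \<open>D\<close> together with a function \<open>A\<close> whose values outside
  \<open>D\<close> are irrelevant.\<close>

definition is_generator ::
  "'a set \<Rightarrow> ('a \<Rightarrow> 'a) \<Rightarrow> (real \<Rightarrow> 'a::cbanach \<Rightarrow> 'a) \<Rightarrow> bool" where
  "is_generator D A T \<longleftrightarrow>
     D = generator_domain T \<and>
     (\<forall>x\<in>D. ((\<lambda>t. (T t x - x) /\<^sub>R t) \<longlongrightarrow> A x) (at_right 0))"

end

(* Put V h = T1 h o T2 h. On D = D(A1) \<inter> D(A2) both V h and T h have right derivative A at h = 0,
   so (V h - T h) x / h tends to 0 for x in D. Telescoping
   V h ^ n x - T (n h) x = (\<Sum>j<n. V h ^ (n - 1 - j) ((V h - T h) (T (j h) x)))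
   with n h = t, stability reduces the claim to convergence of (V h - T h) (T s x) / h to 0
   uniformly in s \<in> [0, b]. Instead of the graph norm of D, take
   x = S y with S = (\<integral> s from 0 to c. T s): such x are dense, S maps the whole space into D and commutes
   with T, so the operators (V h - T h) S / h are bounded and tend strongly to 0. By the uniform
   boundedness principle they do so uniformly on the compact set {T s y | s \<in> [0, b]}. *)

theory Submission
  imports Defs
begin

section \<open>Estimates for families and powers of bounded operators\<close>

lemma uniform_boundedness:
  fixes f :: "'i \<Rightarrow> 'a::banach \<Rightarrow> 'b::real_normed_vector"
  assumes lin: "\<And>i. i \<in> I \<Longrightarrow> bounded_linear (f i)"
    and bdd: "\<And>x. \<exists>B. \<forall>i\<in>I. norm (f i x) \<le> B"
  obtains C where "C \<ge> 0" "\<And>i x. i \<in> I \<Longrightarrow> norm (f i x) \<le> C * norm x"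
proof -
  define F where "F k = {x. \<forall>i\<in>I. norm (f i x) \<le> real k}" for k :: nat
  have closed_F: "closed (F k)" for k
  proof -
    have "closed {x. norm (f i x) \<le> real k}" if "i \<in> I" for i
      by (intro closed_Collect_le continuous_intros linear_continuous_on lin that)
    moreover have "F k = (\<Inter>i\<in>I. {x. norm (f i x) \<le> real k})"
      by (auto simp: F_def)
    ultimately show ?thesis by auto
  qed
  have "\<exists>k. x \<in> F k" for x
  proof -
    from bdd[of x] obtain B where B: "\<forall>i\<in>I. norm (f i x) \<le> B" by blast
    obtain k :: nat where "B \<le> real k" using real_arch_simple by blast
    with B have "x \<in> F k" by (fastforce simp: F_def)
    then show ?thesis ..
  qed
  then have cover: "\<Union>(range F) = UNIV" by blast
  \<comment> \<open>Baire category: countably many closed sets \<open>F k\<close> with empty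
    interior cannot cover a complete space.\<close>
  have "\<exists>k. interior (F k) \<noteq> {}"
  proof (rule ccontr)
    assume "\<not> ?thesis"
    then have "Met_TC.mtopology interior_of \<Union>(range F) = {}"
      by (intro Met_TC.metric_Baire_category_alt)
         (auto simp: closed_F mcomplete_iff_complete complete_UNIV)
    with cover show False by simp
  qed
  then obtain k x0 where "x0 \<in> interior (F k)" by blast
  then obtain r where "r > 0" and r: "cball x0 r \<subseteq> F k"
    by (meson mem_interior_cball)
  show thesis
  proof
    show "0 \<le> 2 * real k / r" using \<open>r > 0\<close> by simp
    fix i x assume "i \<in> I"
    then interpret bounded_linear "f i" by (rule lin)
    show "norm (f i x) \<le> 2 * real k / r * norm x"
    proof (cases "x = 0")
      case False
      \<comment> \<open>Rescaling \<open>x\<close> to norm \<open>r\<close> keeps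
        \<open>x0 + z\<close> in the ball, and linearity expresses \<open>f i z\<close> through two
        values bounded by \<open>k\<close>. The centre \<open>x0\<close> is arbitrary, hence the
        factor 2.\<close>
      define z where "z = (r / norm x) *\<^sub>R x"
      have "norm z = r" using False \<open>r > 0\<close> by (simp add: z_def)
      then have "x0 + z \<in> F k" "x0 \<in> F k"
        using r \<open>r > 0\<close> by (auto simp: dist_norm subset_iff)
      then have "norm (f i (x0 + z)) \<le> k" "norm (f i x0) \<le> k"
        using \<open>i \<in> I\<close> by (auto simp: F_def)
      moreover have "f i z = f i (x0 + z) - f i x0" by (simp add: add)
      ultimately have "norm (f i z) \<le> 2 * real k"
        by (smt (verit) norm_triangle_ineq4)
      then show ?thesis
        using False \<open>r > 0\<close> by (simp add: z_def scaleR field_simps)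
    qed (simp add: zero)
  qed
qed

text \<open>Convergence bounds \<open>f h x\<close> only for \<open>h\<close> below a threshold that
  depends on \<open>x\<close>, so uniform boundedness cannot be applied to a whole interval of
  parameters. If no uniform threshold existed, there would be a sequence \<open>h n\<close> tending
  to 0 with growing operator norms; along a sequence, pointwise convergence does give pointwise
  boundedness, a contradiction.\<close>

lemma eventually_bounded_at_right_0:
  fixes f :: "real \<Rightarrow> 'a::banach \<Rightarrow> 'b::real_normed_vector"
  assumes lin: "\<And>h. h > 0 \<Longrightarrow> bounded_linear (f h)"
    and lim: "\<And>x. ((\<lambda>h. f h x) \<longlongrightarrow> g x) (at_right 0)"
  obtains C where "C > 0" "\<forall>\<^sub>F h in at_right 0. \<forall>x. norm (f h x) \<le> C * norm x"
proof -
  have "\<exists>C>0. \<forall>\<^sub>F h in at_right 0. \<forall>x. norm (f h x) \<le> C * norm x"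
  proof (rule ccontr)
    assume neg: "\<not> ?thesis"
    have "\<exists>h x. 0 < h \<and> h < inverse (real (Suc n)) \<and> real (Suc n) * norm x < norm (f h x)" for n
    proof (rule ccontr)
      assume "\<not> ?thesis"
      then have "\<forall>h>0. h < inverse (real (Suc n)) \<longrightarrow> (\<forall>x. norm (f h x) \<le> real (Suc n) * norm x)"
        by (meson not_less)
      moreover have "0 < inverse (real (Suc n))" by simp
      ultimately have "\<forall>\<^sub>F h in at_right 0. \<forall>x. norm (f h x) \<le> real (Suc n) * norm x"
        unfolding eventually_at_right_field by blast
      moreover have "real (Suc n) > 0" by simp
      ultimately show False using neg by blast
    qed
    then obtain h x where h: "\<And>n. 0 < h n" "\<And>n. h n < inverse (real (Suc n))"
      and x: "\<And>n. real (Suc n) * norm (x n) < norm (f (h n) (x n))" by metis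
    have "h \<longlonglongrightarrow> 0"
      by (rule tendsto_sandwich[OF _ _ tendsto_const LIMSEQ_inverse_real_of_nat])
         (use h in \<open>auto intro!: always_eventually less_imp_le\<close>)
    then have h0: "filterlim h (at_right 0) sequentially"
      using h(1) by (auto simp: filterlim_at intro!: always_eventually less_imp_neq[THEN not_sym])
    have "\<exists>B. \<forall>n\<in>UNIV. norm (f (h n) z) \<le> B" for z
    proof -
      have "(\<lambda>n. f (h n) z) \<longlonglongrightarrow> g z"
        using filterlim_compose[OF lim h0] .
      then have "Bseq (\<lambda>n. f (h n) z)"
        by (rule convergent_imp_Bseq[OF convergentI])
      then show ?thesis by (auto elim!: BseqE)
    qed
    then obtain C where C: "\<And>n z. norm (f (h n) z) \<le> C * norm z"
      using uniform_boundedness[of UNIV "\<lambda>n. f (h n)"] lin h(1) by (metis UNIV_I)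
    obtain n :: nat where "C \<le> real n" using real_arch_simple by blast
    then have "C * norm (x n) \<le> real (Suc n) * norm (x n)"
      by (intro mult_right_mono) auto
    with x[of n] C[of n "x n"] show False by linarith
  qed
  with that show thesis by blast
qed

text \<open>Pointwise convergence is uniform on a finite net of \<open>K\<close>, and the common
  operator bound for small \<open>h\<close> carries it from the net to all of
  \<open>K\<close>.\<close>

lemma uniform_limit_compact_at_right_0:
  fixes f :: "real \<Rightarrow> 'a::banach \<Rightarrow> 'b::real_normed_vector"
  assumes lin: "\<And>h. h > 0 \<Longrightarrow> bounded_linear (f h)"
    and lim: "\<And>x. ((\<lambda>h. f h x) \<longlongrightarrow> 0) (at_right 0)"
    and "compact K"
  shows "uniform_limit K f (\<lambda>_. 0) (at_right 0)"
proof (rule uniform_limitI)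
  fix e :: real assume "e > 0"
  obtain C where "C > 0" and C: "\<forall>\<^sub>F h in at_right 0. \<forall>x. norm (f h x) \<le> C * norm x"
    by (rule eventually_bounded_at_right_0[OF lin lim])
  define r where "r = e / (2 * C)"
  have "r > 0" using \<open>e > 0\<close> \<open>C > 0\<close> by (simp add: r_def)
  obtain F where "finite F" and F: "K \<subseteq> (\<Union>x\<in>F. ball x r)"
    using \<open>compact K\<close> \<open>r > 0\<close> unfolding compact_eq_totally_bounded by blast
  have "\<forall>\<^sub>F h in at_right 0. \<forall>x\<in>F. norm (f h x) < e / 2"
    using \<open>finite F\<close> lim \<open>e > 0\<close>
    by (intro eventually_ball_finite) (force dest!: tendstoD[where e = "e/2"])+
  moreover have "\<forall>\<^sub>F h in at_right (0::real). h > 0"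
    by (simp add: eventually_at_right_less)
  ultimately show "\<forall>\<^sub>F h in at_right 0. \<forall>z\<in>K. dist (f h z) 0 < e"
    using C
  proof eventually_elim
    case (elim h)
    show ?case
    proof
      fix z assume "z \<in> K"
      then obtain x where x: "x \<in> F" "dist x z < r" using F by auto
      interpret bounded_linear "f h" using elim by (intro lin)
      have "norm (f h (z - x)) \<le> C * norm (z - x)" using elim by blast
      also have "\<dots> < C * r" using x \<open>C > 0\<close> by (simp add: dist_norm norm_minus_commute)
      also have "\<dots> = e / 2" using \<open>C > 0\<close> by (simp add: r_def)
      finally have "norm (f h (z - x)) < e / 2" .
      moreover have "norm (f h x) < e / 2" using elim x by blast
      moreover have "f h z = f h (z - x) + f h x" by (simp add: diff)
      ultimately show "dist (f h z) 0 < e"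
        by (smt (verit) dist_0_norm dist_commute field_sum_of_halves norm_triangle_ineq)
    qed
  qed
qed

text \<open>Telescoping: each of the \<open>n\<close> local errors is propagated by a power of
  \<open>V\<close> of norm at most \<open>B\<close>. Only powers below \<open>n\<close> occur, so a
  stability bound on a finite time interval suffices. The sequence \<open>w\<close> will be a
  sampled orbit of the limit semigroup.\<close>

lemma norm_funpow_diff_le:
  assumes "linear V"
    and V: "\<And>k z. k < n \<Longrightarrow> norm ((V ^^ k) z) \<le> B * norm z"
    and w: "\<And>j. j < n \<Longrightarrow> norm (V (w j) - w (Suc j)) \<le> d"
    and "B \<ge> 0"
  shows "norm ((V ^^ n) (w 0) - w n) \<le> real n * (B * d)"
  using V w
proof (induction n arbitrary: w)
  case (Suc n)
  have lin: "linear (V ^^ n)"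
    by (induction n) (simp_all add: linear_ident linear_compose \<open>linear V\<close> del: comp_apply)
  have "norm ((V ^^ n) (V (w 0) - w 1)) \<le> B * norm (V (w 0) - w 1)"
    using Suc.prems(1) by simp
  also have "\<dots> \<le> B * d"
    using Suc.prems(2)[of 0] \<open>B \<ge> 0\<close> by (intro mult_left_mono) auto
  finally have 1: "norm ((V ^^ n) (V (w 0) - w 1)) \<le> B * d" .
  have 2: "norm ((V ^^ n) (w 1) - w (Suc n)) \<le> real n * (B * d)"
    using Suc.IH[of "\<lambda>j. w (Suc j)"] Suc.prems by simp
  \<comment> \<open>Replacing the innermost \<open>V (w 0)\<close> by \<open>w 1\<close> costs one
    propagated local error; the remainder is the same problem for the shifted sequence.\<close>
  have "(V ^^ Suc n) (w 0) - w (Suc n)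
      = (V ^^ n) (V (w 0) - w 1) + ((V ^^ n) (w 1) - w (Suc n))"
    unfolding funpow_Suc_right comp_apply linear_diff[OF lin] by simp
  with norm_triangle_mono[OF 1 2] show ?case
    by (simp only: of_nat_Suc distrib_right mult_1_left)
qed simp

text \<open>Bridge from the derivative in the fundamental theorem of calculus to the difference
  quotients that define generators: to the right of \<open>c\<close>, the norm of
  \<open>u - c\<close> is \<open>u - c\<close> itself.\<close>

lemma has_vector_derivative_at_right_iff:
  fixes f :: "real \<Rightarrow> 'a::real_normed_vector"
  shows "(f has_vector_derivative l) (at_right c) \<longleftrightarrow>
    ((\<lambda>u. (f u - f c) /\<^sub>R (u - c)) \<longlongrightarrow> l) (at_right c)"
proof -
  have "\<forall>\<^sub>F u in at_right c. (f u - f c - (u - c) *\<^sub>R l) /\<^sub>R norm (u - c)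
      = (f u - f c) /\<^sub>R (u - c) - l"
    using eventually_at_right_less[of c] by eventually_elim (simp add: scaleR_diff_right)
  from tendsto_cong[OF this] show ?thesis
    unfolding has_vector_derivative_def has_derivative_at_within
    by (simp add: bounded_linear_scaleR_left LIM_zero_iff)
qed

section \<open>Local boundedness and strong continuity of semigroups\<close>

locale c0_semigroup =
  fixes T :: "real \<Rightarrow> 'a::cbanach \<Rightarrow> 'a"
  assumes C0: "C0_semigroup T"
begin

lemma bounded_linear: "t \<ge> 0 \<Longrightarrow> bounded_linear (T t)"
  using C0 by (simp add: C0_semigroup_def bounded_clinear_def)

lemma apply_zero [simp]: "T 0 x = x"
  using C0 by (simp add: C0_semigroup_def)

lemma apply_add: "t \<ge> 0 \<Longrightarrow> s \<ge> 0 \<Longrightarrow> T (t + s) x = T t (T s x)"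
  using C0 by (simp add: C0_semigroup_def)

lemma tendsto_at_right_0: "((\<lambda>t. T t x) \<longlongrightarrow> x) (at_right 0)"
  using C0 by (simp add: C0_semigroup_def)

text \<open>Strong continuity at 0 bounds \<open>T t\<close> on some \<open>[0, d)\<close>, and the
  semigroup law extends the bound to \<open>[0, b]\<close> in finitely many steps. This supplies a
  bound for the limit semigroup, which is not given in a class \<open>SG\<close>.\<close>

lemma bounded_on_interval:
  obtains C where "C \<ge> 1" "\<And>t x. 0 \<le> t \<Longrightarrow> t \<le> b \<Longrightarrow> norm (T t x) \<le> C * norm x"
proof -
  obtain C where "C > 0" and "\<forall>\<^sub>F t in at_right 0. \<forall>x. norm (T t x) \<le> C * norm x"
    by (rule eventually_bounded_at_right_0[of T "\<lambda>x. x"])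
       (simp_all add: bounded_linear tendsto_at_right_0)
  then obtain d where "d > 0" and d: "\<And>t x. 0 < t \<Longrightarrow> t < d \<Longrightarrow> norm (T t x) \<le> C * norm x"
    unfolding eventually_at_right_field by blast
  define c where "c = max C 1"
  have "c \<ge> 1" by (simp add: c_def)
  have c: "norm (T t x) \<le> c * norm x" if "0 \<le> t" "t < d" for t x
  proof (cases "t = 0")
    case True
    then show ?thesis using mult_right_mono[OF \<open>c \<ge> 1\<close>, of "norm x"] by simp
  next
    case False
    then have "norm (T t x) \<le> C * norm x" using d that by simp
    also have "\<dots> \<le> c * norm x" by (intro mult_right_mono) (auto simp: c_def)
    finally show ?thesis .
  qed
  have step: "norm (T t x) \<le> c ^ m * norm x" if "0 \<le> t" "t \<le> real m * (d / 2)" for t m x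
    using that
  proof (induction m arbitrary: t x)
    case (Suc m)
    \<comment> \<open>A step of at most \<open>d / 2\<close> stays strictly below \<open>d\<close>,
      where \<open>c\<close> is a bound, and leaves a time covered by \<open>m\<close> further
      steps.\<close>
    define s where "s = min t (d / 2)"
    have s: "0 \<le> s" "s < d" "0 \<le> t - s" "t - s \<le> real m * (d / 2)"
      using Suc.prems \<open>d > 0\<close> by (auto simp: s_def min_def algebra_simps)
    have "T t x = T s (T (t - s) x)" using apply_add[of s "t - s" x] s by simp
    then have "norm (T t x) \<le> c * norm (T (t - s) x)" using c s by simp
    also have "\<dots> \<le> c * (c ^ m * norm x)"
      using Suc.IH s \<open>c \<ge> 1\<close> by (intro mult_left_mono) auto
    finally show ?case by (simp add: mult.assoc)
  qed simp
  obtain m :: nat where "b / (d / 2) \<le> real m" using real_arch_simple by blast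
  then have "b \<le> real m * (d / 2)" using \<open>d > 0\<close> by (simp add: field_simps)
  with step have "norm (T t x) \<le> c ^ m * norm x" if "0 \<le> t" "t \<le> b" for t x
    using that by fastforce
  moreover have "c ^ m \<ge> 1" using \<open>c \<ge> 1\<close> by simp
  ultimately show thesis using that by blast
qed

text \<open>Local boundedness makes \<open>T t (u t - l)\<close> vanish in the limit, while
  \<open>T t l\<close> tends to \<open>l\<close>. It serves the product rule, where one semigroup
  acts on the difference quotient of the other.\<close>

lemma tendsto_apply:
  assumes "(u \<longlongrightarrow> l) (at_right 0)"
  shows "((\<lambda>t. T t (u t)) \<longlongrightarrow> l) (at_right 0)"
proof -
  obtain C where C: "\<And>t x. 0 \<le> t \<Longrightarrow> t \<le> 1 \<Longrightarrow> norm (T t x) \<le> C * norm x"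
    using bounded_on_interval[of 1] by metis
  have "\<forall>\<^sub>F t in at_right (0::real). 0 < t \<and> t < 1"
    by (rule eventually_at_rightI[of 0 1]) auto
  then have ev: "\<forall>\<^sub>F t in at_right 0. norm (T t (u t - l)) \<le> norm (u t - l) * C"
    by eventually_elim (use C in \<open>auto simp: mult.commute\<close>)
  have "((\<lambda>t. u t - l) \<longlongrightarrow> 0) (at_right 0)"
    using tendsto_diff[OF assms tendsto_const[of l]] by simp
  then have "((\<lambda>t. T t (u t - l)) \<longlongrightarrow> 0) (at_right 0)"
    using ev by (rule tendsto_0_le)
  from tendsto_add[OF this tendsto_at_right_0[of l]]
  have "((\<lambda>t. T t (u t - l) + T t l) \<longlongrightarrow> l) (at_right 0)" by simp
  moreover have "\<forall>\<^sub>F t in at_right 0. T t (u t - l) + T t l = T t (u t)"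
    using eventually_at_right_less[of 0]
    by eventually_elim (simp add: linear_diff[OF bounded_linear.linear[OF bounded_linear]])
  ultimately show ?thesis by (rule Lim_transform_eventually)
qed

text \<open>Factoring out \<open>T\<close> at the earlier of two times leaves an increment at 0,
  where continuity is known. The bound on \<open>[0, b]\<close> then yields continuity from both
  sides.\<close>

lemma continuous_on_orbit: "continuous_on {0..b} (\<lambda>t. T t x)"
proof -
  obtain C where "C \<ge> 1" and C: "\<And>t x. 0 \<le> t \<Longrightarrow> t \<le> b \<Longrightarrow> norm (T t x) \<le> C * norm x"
    using bounded_on_interval[of b] by blast
  have le: "dist (T s x) (T t x) \<le> C * dist (T (t - s) x) x" if "0 \<le> s" "s \<le> t" "t \<le> b" for s t
  proof -
    have "T t x = T s (T (t - s) x)" using apply_add[of s "t - s"] that by simp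
    then have "T t x - T s x = T s (T (t - s) x - x)"
      using that by (simp add: linear_diff[OF bounded_linear.linear[OF bounded_linear]])
    moreover have "norm (T s (T (t - s) x - x)) \<le> C * norm (T (t - s) x - x)"
      using C that by simp
    ultimately show ?thesis by (metis dist_commute dist_norm)
  qed
  show ?thesis
    unfolding continuous_on_iff
  proof (intro ballI allI impI)
    fix s e :: real assume s: "s \<in> {0..b}" and "e > 0"
    then have "e / C > 0" using \<open>C \<ge> 1\<close> by simp
    from tendstoD[OF tendsto_at_right_0[of x] this] obtain d where "d > 0"
      and d: "\<And>r. 0 < r \<Longrightarrow> r < d \<Longrightarrow> dist (T r x) x < e / C"
      unfolding eventually_at_right_field by blast
    show "\<exists>d>0. \<forall>t\<in>{0..b}. dist t s < d \<longrightarrow> dist (T t x) (T s x) < e"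
    proof (intro exI conjI ballI impI)
      fix t assume t: "t \<in> {0..b}" "dist t s < d"
      show "dist (T t x) (T s x) < e"
      proof (cases "t = s")
        case False
        have "dist (T t x) (T s x) \<le> C * dist (T \<bar>t - s\<bar> x) x"
          using le[of s t] le[of t s] s t by (cases "s \<le> t") (auto simp: dist_commute abs_if)
        also have "\<dots> < C * (e / C)"
          using d[of "\<bar>t - s\<bar>"] False t \<open>C \<ge> 1\<close> by (intro mult_strict_left_mono) (auto simp: dist_real_def)
        finally show ?thesis using \<open>C \<ge> 1\<close> by simp
      qed (use \<open>e > 0\<close> in simp)
    qed (rule \<open>d > 0\<close>)
  qed
qed

section \<open>Orbit integrals as smoothing operators into the generator domain\<close>

definition orbit_integral :: "real \<Rightarrow> 'a \<Rightarrow> 'a" where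
  "orbit_integral c x = integral {0..c} (\<lambda>s. T s x)"

lemma orbit_integrable: "a \<ge> 0 \<Longrightarrow> (\<lambda>s. T s x) integrable_on {a..b}"
  by (intro integrable_continuous_interval continuous_on_subset[OF continuous_on_orbit[of b x]]) auto

lemma bounded_linear_orbit_integral:
  assumes "c \<ge> 0"
  shows "bounded_linear (orbit_integral c)"
proof -
  obtain C where C: "\<And>t x. 0 \<le> t \<Longrightarrow> t \<le> c \<Longrightarrow> norm (T t x) \<le> C * norm x"
    using bounded_on_interval[of c] by metis
  show ?thesis
  proof (rule bounded_linear_intro)
    fix x y r
    have "orbit_integral c (x + y) = integral {0..c} (\<lambda>s. T s x + T s y)"
      unfolding orbit_integral_def
      by (intro integral_cong) (auto simp: linear_add[OF bounded_linear.linear[OF bounded_linear]])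
    then show "orbit_integral c (x + y) = orbit_integral c x + orbit_integral c y"
      unfolding orbit_integral_def by (simp add: integral_add orbit_integrable)
    have "orbit_integral c (r *\<^sub>R x) = integral {0..c} (\<lambda>s. r *\<^sub>R T s x)"
      unfolding orbit_integral_def
      by (intro integral_cong) (auto simp: linear_cmul[OF bounded_linear.linear[OF bounded_linear]])
    then show "orbit_integral c (r *\<^sub>R x) = r *\<^sub>R orbit_integral c x"
      unfolding orbit_integral_def by simp
    have "norm (orbit_integral c x) \<le> C * norm x * (c - 0)"
      unfolding orbit_integral_def using assms C
      by (intro integral_bound continuous_on_orbit) auto
    then show "norm (orbit_integral c x) \<le> norm x * (C * c)" by (simp add: ac_simps)
  qed
qed

text \<open>A bounded operator passes through the integral, and \<open>T t\<close> commutes with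
  each \<open>T s\<close> because times add commutatively. Orbits starting in the range of the
  integral operator therefore stay in it.\<close>

lemma orbit_integral_commute:
  assumes "t \<ge> 0" "c \<ge> 0"
  shows "T t (orbit_integral c x) = orbit_integral c (T t x)"
proof -
  have "T t (orbit_integral c x) = integral {0..c} (T t \<circ> (\<lambda>s. T s x))"
    unfolding orbit_integral_def
    using integral_linear[OF orbit_integrable bounded_linear[OF assms(1)]] by simp
  also have "\<dots> = integral {0..c} (\<lambda>s. T s (T t x))"
  proof (intro integral_cong)
    fix s assume "s \<in> {0..c}"
    then show "(T t \<circ> (\<lambda>s. T s x)) s = T s (T t x)"
      using apply_add[of t s x] apply_add[of s t x] assms by (simp add: add.commute)
  qed
  finally show ?thesis by (simp add: orbit_integral_def)
qed

text \<open>\<open>T h\<close> moves the integration interval to \<open>[h, c + h]\<close>. Written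
  as a difference of two integrals from 0, the result can be differentiated in \<open>h\<close>
  through the upper limits.\<close>

lemma orbit_integral_shift:
  assumes "h \<ge> 0" "c \<ge> 0"
  shows "T h (orbit_integral c x) = orbit_integral (c + h) x - orbit_integral h x"
proof -
  have "T h (orbit_integral c x) = integral {0..c} (T h \<circ> (\<lambda>s. T s x))"
    unfolding orbit_integral_def
    using integral_linear[OF orbit_integrable bounded_linear[OF assms(1)]] by simp
  also have "\<dots> = integral {0..c} ((\<lambda>s. T s x) \<circ> (+) h)"
    by (intro integral_cong) (use assms in \<open>auto simp: apply_add\<close>)
  also have "\<dots> = integral {h..c + h} (\<lambda>s. T s x)"
    by (subst integral_shift_Icc_real) simp
  also have "\<dots> = orbit_integral (c + h) x - orbit_integral h x"
    unfolding orbit_integral_def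
    using Henstock_Kurzweil_Integration.integral_combine[of 0 h "c + h" "\<lambda>s. T s x"] assms orbit_integrable
    by (simp add: algebra_simps)
  finally show ?thesis .
qed

lemma orbit_integral_right_derivative:
  assumes "c \<ge> 0"
  shows "((\<lambda>h. (orbit_integral (c + h) x - orbit_integral c x) /\<^sub>R h) \<longlongrightarrow> T c x) (at_right 0)"
proof -
  \<comment> \<open>The upper end \<open>c + 1\<close> leaves room to the right of \<open>c\<close>,
    also when \<open>c = 0\<close>; orbits are controlled only at nonnegative times.\<close>
  have "((\<lambda>u. orbit_integral u x) has_vector_derivative T c x) (at c within {0..c + 1})"
    unfolding orbit_integral_def using assms
    by (intro integral_has_vector_derivative continuous_on_orbit) auto
  then have "((\<lambda>u. orbit_integral u x) has_vector_derivative T c x) (at c within {c..c + 1})"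
    by (rule has_vector_derivative_within_subset) (use assms in auto)
  moreover have "at c within {c..c + 1} = at_right c"
    by (rule at_within_Icc_at_right) simp
  ultimately have "((\<lambda>u. (orbit_integral u x - orbit_integral c x) /\<^sub>R (u - c)) \<longlongrightarrow> T c x) (at_right c)"
    by (simp add: has_vector_derivative_at_right_iff)
  then show ?thesis
    by (subst (asm) filterlim_at_right_to_0) (simp add: add.commute)
qed

text \<open>The case \<open>c = 0\<close> of the right derivative. It gives density of the orbit
  integrals, since the factor \<open>1 / c\<close> can be absorbed into the argument.\<close>

lemma orbit_integral_average_tendsto:
  "((\<lambda>c. orbit_integral c x /\<^sub>R c) \<longlongrightarrow> x) (at_right 0)"
  using orbit_integral_right_derivative[of 0 x] by (simp add: orbit_integral_def)

text \<open>By the shift identity, the difference quotient splits into right derivatives of the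
  integral at \<open>c\<close> and at 0, so the generator takes the value
  \<open>T c x - x\<close>.\<close>

lemma orbit_integral_in_generator_domain:
  assumes "c \<ge> 0"
  shows "orbit_integral c x \<in> generator_domain T"
proof -
  have "((\<lambda>h. (orbit_integral (c + h) x - orbit_integral c x) /\<^sub>R h - orbit_integral h x /\<^sub>R h)
      \<longlongrightarrow> T c x - x) (at_right 0)"
    by (intro tendsto_diff orbit_integral_right_derivative orbit_integral_average_tendsto assms)
  moreover have "\<forall>\<^sub>F h in at_right 0.
      (orbit_integral (c + h) x - orbit_integral c x) /\<^sub>R h - orbit_integral h x /\<^sub>R h
      = (T h (orbit_integral c x) - orbit_integral c x) /\<^sub>R h"
    using eventually_at_right_less[of 0]
    by eventually_elim (simp add: orbit_integral_shift assms algebra_simps)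
  ultimately have "((\<lambda>h. (T h (orbit_integral c x) - orbit_integral c x) /\<^sub>R h)
      \<longlongrightarrow> T c x - x) (at_right 0)"
    by (rule Lim_transform_eventually)
  then show ?thesis by (auto simp: generator_domain_def)
qed

end

section \<open>Convergence of the Trotter products\<close>

theorem mainTheorem1:
  fixes T1 T2 T :: "real \<Rightarrow> 'a::cbanach \<Rightarrow> 'a"
    and A1 A2 A :: "'a \<Rightarrow> 'a"
    and D1 D2 D :: "'a set"
    and M1 M2 \<omega>1 \<omega>2 :: real
  assumes "M1 \<ge> 1" and "\<omega>1 \<ge> 0" and "M2 \<ge> 1" and "\<omega>2 \<ge> 0"
    and "T1 \<in> SG M1 \<omega>1" and "is_generator D1 A1 T1"
    and "T2 \<in> SG M2 \<omega>2" and "is_generator D2 A2 T2"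
    and "\<exists>\<omega> M. \<omega> \<ge> 0 \<and> M \<ge> 1 \<and>
           (\<forall>k::nat. k \<ge> 1 \<longrightarrow> (\<forall>t\<ge>0.
              onorm ((T1 t \<circ> T2 t) ^^ k) \<le> M * exp (real k * \<omega> * t)))"
    and "D = D1 \<inter> D2" and "\<forall>x\<in>D. A x = A1 x + A2 x"
    and "C0_semigroup T" and "is_generator D A T"
  shows "\<forall>x. \<forall>a b. 0 \<le> a \<and> a \<le> b \<longrightarrow>
           uniform_limit {a..b}
             (\<lambda>n t. ((T1 (t / real n) \<circ> T2 (t / real n)) ^^ n) x)
             (\<lambda>t. T t x) sequentially"
proof (intro allI impI)
  interpret S1: c0_semigroup T1 using assms(5) by unfold_locales (simp add: SG_def)
  interpret S2: c0_semigroup T2 using assms(7) by unfold_locales (simp add: SG_def)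
  interpret S: c0_semigroup T using assms(12) by unfold_locales
  obtain \<omega> M where "\<omega> \<ge> 0" "M \<ge> 1" and stable: "\<And>k t. k \<ge> 1 \<Longrightarrow> t \<ge> 0 \<Longrightarrow>
      onorm ((T1 t \<circ> T2 t) ^^ k) \<le> M * exp (real k * \<omega> * t)"
    using assms(9) by metis
  define V where "V t = T1 t \<circ> T2 t" for t
  have V_lin: "bounded_linear (V t)" if "t \<ge> 0" for t
    unfolding V_def comp_def using that
    by (intro bounded_linear_compose[of "T1 t" "T2 t"] S1.bounded_linear S2.bounded_linear)
  have Vk_lin: "bounded_linear (V t ^^ k)" if "t \<ge> 0" for t k
  proof (induction k)
    case (Suc k)
    then show ?case
      using bounded_linear_compose[OF V_lin[OF that] Suc] by (simp add: comp_def)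
  qed (simp add: id_def)
  \<comment> \<open>Product rule: \<open>V h x - x\<close> is \<open>T1 h x - x\<close> plus
    \<open>T1 h\<close> applied to \<open>T2 h x - x\<close>.\<close>
  have V_deriv: "((\<lambda>h. (V h x - x) /\<^sub>R h) \<longlongrightarrow> A x) (at_right 0)" if "x \<in> D" for x
  proof -
    have x1: "((\<lambda>h. (T1 h x - x) /\<^sub>R h) \<longlongrightarrow> A1 x) (at_right 0)"
      and x2: "((\<lambda>h. (T2 h x - x) /\<^sub>R h) \<longlongrightarrow> A2 x) (at_right 0)"
      using assms(6,8,10) that by (auto simp: is_generator_def)
    have "((\<lambda>h. (T1 h x - x) /\<^sub>R h + T1 h ((T2 h x - x) /\<^sub>R h)) \<longlongrightarrow> A1 x + A2 x) (at_right 0)"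
      by (intro tendsto_add x1 S1.tendsto_apply x2)
    moreover have "\<forall>\<^sub>F h in at_right 0.
        (T1 h x - x) /\<^sub>R h + T1 h ((T2 h x - x) /\<^sub>R h) = (V h x - x) /\<^sub>R h"
      using eventually_at_right_less[of 0]
    proof eventually_elim
      case (elim h)
      then interpret bounded_linear "T1 h" by (intro S1.bounded_linear) simp
      show ?case by (simp add: V_def scaleR diff algebra_simps)
    qed
    ultimately have "((\<lambda>h. (V h x - x) /\<^sub>R h) \<longlongrightarrow> A1 x + A2 x) (at_right 0)"
      by (rule Lim_transform_eventually)
    then show ?thesis using assms(11) that by simp
  qed

  fix x a b assume ab: "0 \<le> a \<and> a \<le> (b::real)"
  then have "b \<ge> 0" by simp
  \<comment> \<open>For \<open>k\<close> at most \<open>n\<close> and \<open>t\<close> at most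
    \<open>b\<close>, the exponent \<open>k * \<omega> * t / n\<close> is at most
    \<open>\<omega> * b\<close>, so \<open>B\<close> bounds all these powers. The stability
    hypothesis starts at \<open>k = 1\<close>; the power 0 is covered by
    \<open>B \<ge> 1\<close>.\<close>
  define B where "B = M * exp (\<omega> * b)"
  have "B \<ge> 1"
    using mult_mono[of 1 M 1 "exp (\<omega> * b)"] \<open>M \<ge> 1\<close> \<open>\<omega> \<ge> 0\<close> \<open>b \<ge> 0\<close> by (simp add: B_def)
  have B: "norm ((V (t / real n) ^^ k) z) \<le> B * norm z" if "0 \<le> t" "t \<le> b" "k \<le> n" for t n k z
  proof (cases "k = 0")
    case True
    then show ?thesis using mult_right_mono[OF \<open>B \<ge> 1\<close>, of "norm z"] by simp
  next
    case False
    then have "n > 0" using that by simp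
    have "real k * (t / real n) \<le> real n * (t / real n)"
      using that by (intro mult_right_mono) auto
    also have "\<dots> = t" using \<open>n > 0\<close> by simp
    finally have "real k * (t / real n) \<le> b" using that by simp
    then have "\<omega> * (real k * (t / real n)) \<le> \<omega> * b"
      using \<open>\<omega> \<ge> 0\<close> by (rule mult_left_mono)
    then have "real k * \<omega> * (t / real n) \<le> \<omega> * b" by (simp add: ac_simps)
    then have "M * exp (real k * \<omega> * (t / real n)) \<le> B"
      unfolding B_def using \<open>M \<ge> 1\<close> by (intro mult_left_mono) auto
    then have "onorm (V (t / real n) ^^ k) \<le> B"
      using stable[of k "t / real n"] False that by (simp add: V_def)
    moreover have "norm ((V (t / real n) ^^ k) z) \<le> onorm (V (t / real n) ^^ k) * norm z"
      by (intro onorm Vk_lin) (use that in auto)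
    ultimately show ?thesis by (meson mult_right_mono norm_ge_zero order_trans)
  qed
  obtain C where "C \<ge> 1" and C: "\<And>t z. 0 \<le> t \<Longrightarrow> t \<le> b \<Longrightarrow> norm (T t z) \<le> C * norm z"
    using S.bounded_on_interval[of b] by blast
  have "uniform_limit {a..b} (\<lambda>n t. (V (t / real n) ^^ n) x) (\<lambda>t. T t x) sequentially"
  proof (rule uniform_limitI)
    fix e :: real assume "e > 0"
    \<comment> \<open>Chosen so that replacing \<open>x\<close> by an approximation within
      \<open>r\<close> costs at most \<open>(B + C) * r = e / 3\<close> in both orbits
      together.\<close>
    define r where "r = e / (3 * (B + C))"
    have "r > 0" using \<open>e > 0\<close> \<open>B \<ge> 1\<close> \<open>C \<ge> 1\<close> by (simp add: r_def)
    have "\<forall>\<^sub>F c in at_right 0. dist (S.orbit_integral c x /\<^sub>R c) x < r"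
      using tendstoD[OF S.orbit_integral_average_tendsto \<open>r > 0\<close>] .
    then obtain c where "c > 0" and c: "dist (S.orbit_integral c x /\<^sub>R c) x < r"
      unfolding eventually_at_right_field using dense by metis
    interpret K: bounded_linear "S.orbit_integral c"
      using S.bounded_linear_orbit_integral \<open>c > 0\<close> by simp
    \<comment> \<open>Absorbing \<open>1 / c\<close> makes \<open>x'\<close> both the average close
      to \<open>x\<close> and an orbit integral.\<close>
    define y where "y = x /\<^sub>R c"
    define x' where "x' = S.orbit_integral c y"
    have xx': "norm (x - x') \<le> r"
      using c by (simp add: x'_def y_def K.scaleR dist_norm norm_minus_commute)
    define f where "f h z = (V h (S.orbit_integral c z) - T h (S.orbit_integral c z)) /\<^sub>R h" for h z
    have f_lin: "bounded_linear (f h)" if "h > 0" for h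
      unfolding f_def using that
      by (intro bounded_linear_const_scaleR bounded_linear_sub
          bounded_linear_compose[OF V_lin K.bounded_linear_axioms]
          bounded_linear_compose[OF S.bounded_linear K.bounded_linear_axioms]) auto
    have f_lim: "((\<lambda>h. f h z) \<longlongrightarrow> 0) (at_right 0)" for z
    proof -
      let ?u = "S.orbit_integral c z"
      \<comment> \<open>Here the generator hypothesis enters: \<open>D\<close> is the generator
        domain of \<open>T\<close>, so smoothing by \<open>T\<close> alone lands in
        \<open>D1 \<inter> D2\<close>.\<close>
      have u: "?u \<in> D"
        using assms(13) S.orbit_integral_in_generator_domain[of c z] \<open>c > 0\<close>
        by (simp add: is_generator_def)
      then have "((\<lambda>h. (T h ?u - ?u) /\<^sub>R h) \<longlongrightarrow> A ?u) (at_right 0)"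
        using assms(13) by (auto simp: is_generator_def)
      from tendsto_diff[OF V_deriv[OF u] this] show ?thesis
        by (simp add: f_def flip: scaleR_diff_right)
    qed
    have "compact ((\<lambda>s. T s y) ` {0..b})"
      by (intro compact_continuous_image S.continuous_on_orbit compact_Icc)
    then have unif: "uniform_limit ((\<lambda>s. T s y) ` {0..b}) f (\<lambda>_. 0) (at_right 0)"
      by (intro uniform_limit_compact_at_right_0 f_lin f_lim)
    \<comment> \<open>The accumulated error \<open>t * B * d\<close> must stay below
      \<open>e / 3\<close> for all \<open>t \<le> b\<close>; \<open>b + 1\<close> keeps the divisor
      positive when \<open>b = 0\<close>.\<close>
    define d where "d = e / (3 * (B * (b + 1)))"
    have "d > 0" using \<open>e > 0\<close> \<open>B \<ge> 1\<close> \<open>b \<ge> 0\<close> by (simp add: d_def)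
    from uniform_limitD[OF unif this] obtain \<delta> where "\<delta> > 0"
      and \<delta>: "\<And>h s. 0 < h \<Longrightarrow> h < \<delta> \<Longrightarrow> 0 \<le> s \<Longrightarrow> s \<le> b \<Longrightarrow> norm (f h (T s y)) < d"
      unfolding eventually_at_right_field by auto
    \<comment> \<open>The condition on \<open>n\<close> involves only \<open>b\<close>, so the step
      \<open>t / n\<close> is below \<open>\<delta>\<close> for all \<open>t\<close> at once. The
      time 0 is separate because \<open>f\<close> divides by the step.\<close>
    have main: "dist ((V (t / real n) ^^ n) x) (T t x) < e"
      if n: "n > 0" "b / real n < \<delta>" and t: "t \<in> {a..b}" for n t
    proof (cases "t = 0")
      case True
      have "(V 0 ^^ n) x = x" by (induction n) (auto simp: V_def)
      then show ?thesis using True \<open>e > 0\<close> by simp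
    next
      case False
      have "t > 0" "t \<le> b" using t False ab by auto
      define h where "h = t / real n"
      have "h > 0" using \<open>t > 0\<close> n by (simp add: h_def)
      have "h < \<delta>" using n \<open>t \<le> b\<close> divide_right_mono[of t b "real n"] by (simp add: h_def)
      have hn: "real n * h = t" using n by (simp add: h_def)
      define w where "w j = T (real j * h) x'" for j
      \<comment> \<open>The local error is \<open>h\<close> times a small quantity, so the sum over
        \<open>n = t / h\<close> steps stays small.\<close>
      have "norm (V h (w j) - w (Suc j)) \<le> h * d" if "j < n" for j
      proof -
        have "real j * h \<le> real n * h" using that \<open>h > 0\<close> by (intro mult_right_mono) auto
        then have j: "0 \<le> real j * h" "real j * h \<le> b" using hn \<open>t \<le> b\<close> \<open>h > 0\<close> by auto
        have "w (Suc j) = T h (w j)"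
          using S.apply_add[of h "real j * h"] j \<open>h > 0\<close> by (simp add: w_def algebra_simps)
        moreover have "w j = S.orbit_integral c (T (real j * h) y)"
          using S.orbit_integral_commute j \<open>c > 0\<close> by (simp add: w_def x'_def)
        ultimately have "V h (w j) - w (Suc j) = h *\<^sub>R f h (T (real j * h) y)"
          using \<open>h > 0\<close> by (simp add: f_def)
        then have "norm (V h (w j) - w (Suc j)) = h * norm (f h (T (real j * h) y))"
          using \<open>h > 0\<close> by simp
        also have "\<dots> \<le> h * d"
          using \<delta>[OF \<open>h > 0\<close> \<open>h < \<delta>\<close> j] \<open>h > 0\<close> by (intro mult_left_mono) auto
        finally show ?thesis .
      qed
      then have "norm ((V h ^^ n) (w 0) - w n) \<le> real n * (B * (h * d))"
        using B[of t _ n] \<open>t > 0\<close> \<open>t \<le> b\<close> \<open>B \<ge> 1\<close> V_lin[of h] \<open>h > 0\<close>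
        by (intro norm_funpow_diff_le) (auto simp: h_def bounded_linear.linear)
      also have "\<dots> = t * (B * d)" using hn by (simp add: algebra_simps)
      also have "\<dots> < (b + 1) * (B * d)"
        using \<open>t \<le> b\<close> \<open>B \<ge> 1\<close> \<open>d > 0\<close> by (intro mult_strict_right_mono) auto
      also have "\<dots> = (B * (b + 1)) * d" by simp
      also have "\<dots> = e / 3" using \<open>B \<ge> 1\<close> \<open>b \<ge> 0\<close> by (simp add: d_def)
      finally have 1: "norm ((V h ^^ n) x' - T t x') < e / 3"
        by (simp add: w_def hn)
      have "norm ((V h ^^ n) (x - x')) + norm (T t (x - x')) \<le> B * norm (x - x') + C * norm (x - x')"
        using B[of t n n "x - x'"] C[of t "x - x'"] \<open>t > 0\<close> \<open>t \<le> b\<close> by (simp add: h_def)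
      also have "\<dots> \<le> (B + C) * r"
        using mult_left_mono[OF xx', of "B + C"] \<open>B \<ge> 1\<close> \<open>C \<ge> 1\<close> by (simp add: distrib_right)
      also have "\<dots> = e / 3" using \<open>B \<ge> 1\<close> \<open>C \<ge> 1\<close> by (simp add: r_def field_split_simps)
      finally have 2: "norm ((V h ^^ n) (x - x')) + norm (T t (x - x')) \<le> e / 3" .
      \<comment> \<open>By linearity, the error splits into that for the smoothed vector and the two
        orbits of \<open>x - x'\<close>.\<close>
      have "(V h ^^ n) x - T t x = ((V h ^^ n) x' - T t x') + ((V h ^^ n) (x - x') - T t (x - x'))"
        using Vk_lin[of h n] S.bounded_linear[of t] \<open>h > 0\<close> \<open>t > 0\<close>
        by (simp add: linear_diff bounded_linear.linear)
      then have "norm ((V h ^^ n) x - T t x) \<le> norm ((V h ^^ n) x' - T t x')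
          + (norm ((V h ^^ n) (x - x')) + norm (T t (x - x')))"
        by (simp only: norm_triangle_mono norm_triangle_ineq4 order_refl)
      then show ?thesis using 1 2 \<open>e > 0\<close> by (simp add: dist_norm h_def)
    qed
    have "(\<lambda>n. b / real n) \<longlonglongrightarrow> 0" by (rule lim_const_over_n)
    then have "\<forall>\<^sub>F n in sequentially. b / real n < \<delta>"
      using \<open>\<delta> > 0\<close> by (rule order_tendstoD)
    then show "\<forall>\<^sub>F n in sequentially. \<forall>t\<in>{a..b}. dist ((V (t / real n) ^^ n) x) (T t x) < e"
      using eventually_gt_at_top[of 0] by eventually_elim (use main in blast)
  qed
  then show "uniform_limit {a..b} (\<lambda>n t. ((T1 (t / real n) \<circ> T2 (t / real n)) ^^ n) x)
      (\<lambda>t. T t x) sequentially"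
    by (simp add: V_def)
qed

end
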